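(* Suppose the initial moments are realizable, $\mathbf{m}^0_i\in\mathcal{R}_M$ for every cell $i=1,\ldots,N_x$, the boundary conditions are treated via the direct kinetic approach, and a positive weighting $\mathbf{w}$ is used for the reconstruction. Then the update $$\mathbf{m}^{n+1}_i=\mathbf{m}^n_i-\frac{\Delta t}{\Delta x}\big(\mathbf{F}^{\mathrm{lo}}_{i+1/2}-\mathbf{F}^{\mathrm{lo}}_{i-1/2}\big),\qquad \mathbf{F}^{\mathrm{lo}}_{i+1/2}=\tfrac12(\mathbf{F}^n_i+\mathbf{F}^n_{i+1})-\tfrac12\mathbf{A}\mathcal{D}_{i+1/2}(\mathbf{f}^{\ast,n}_{i+1}-\mathbf{f}^{\ast,n}_i),$$ leads to a realizable set of moments everywhere in the domain (i.e. $\mathbf{m}^n_i\in\mathcal{R}_M$ for all $i$ and all $n\ge0$), provided the numerical viscosities satisfy $$|v_{l,x}|\le a_{l,i+1/2}\le\frac{\Delta x}{\Delta t}\qquad\text{for every node }l\text{ and every interface }x_{i+1/2}.$$ This condition can be fulfilled (the interval $[|v_{l,x}|,\Delta x/\Delta t]$ is non-empty for every $l$) exactly when the CFL condition $\max_l|v_{l,x}|\frac{\Delta t}{\Delta x}\le1$ is satisfied, and then all three choices $$a_{l,i+1/2}=\Delta x/\Delta t\ \text{(Lax-Friedrichs)},\qquad a_{l,i+1/2}=|v_{l,x}|\ \text{(upwind)},\qquad a_{l,i+1/2}=\max_k|v_{k,x}|\ \text{(global Rusanov)}$$ satisfy it, the Lax-Friedrichs and upwind choices being its two endpoints. In particular,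 the Lax-Friedrichs, upwind and global Rusanov schemes all preserve realizability under that CFL condition.
   Context: Velocity discretization (fixed): $d\ge1$; nodes $\mathbf{v}_1,\ldots,\mathbf{v}_N\in\mathbb{R}^d$, with $v_{l,x}$ the $x$-component of $\mathbf{v}_l$; weights $\Delta v_l>0$; multi-indices $\boldsymbol{\alpha}_1,\ldots,\boldsymbol{\alpha}_M\in\mathbb{N}_0^d$ containing the zero multi-index; $p_k(\mathbf{v})=\prod_iv_i^{\alpha_{k,i}}$; $\mathbf{A}_{kl}=\Delta v_lp_k(\mathbf{v}_l)$, with $N>M$ and $\mathrm{rank}(\mathbf{A})=M$. The grid has nodes with $v_{l,x}>0$ and nodes with $v_{l,x}<0$. $\mathcal{R}_M=\{\mathbf{A}\mathbf{f}:\mathbf{f}\in\mathbb{R}^N,\ f_l>0\ \forall l\}$. Reconstruction: for $\mathbf{m}\in\mathcal{R}_M$, a weighting $w_l>0$ and $\lambda\ge0$, $f^{\ast}_l=w_lg^{\ast}_l$, where $\mathbf{g}^{\ast}$ is the unique minimizer of $\sum_l\Delta v_lw_lg_l\log(w_lg_l)+\lambda\sum_l|g_l|$ over $g_l\ge0$ with $\sum_l\mathbf{A}_{kl}w_lg_l=m_k$, $k=1,\ldots,M$ ($0\log0=0$). $\mathbf{f}^{\ast,n}_i$ denotes the reconstruction from the moments $\mathbf{m}^n_i$ in cell $i$ at time step $n$. Scheme: transport is one-dimensional in $x$, on a uniform spatial grid with cells $i=1,\ldots,N_x$ of size $\Delta x>0$, time step $\Delta t>0$. $\mathcal{V}_x=\mathrm{diag}(v_{1,x},\ldots,v_{N,x})$;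 $\mathbf{m}^n_i=\mathbf{A}\mathbf{f}^{\ast,n}_i$ and $\mathbf{F}^n_i=\mathbf{A}\mathcal{V}_x\mathbf{f}^{\ast,n}_i$; $\mathcal{D}_{i+1/2}=\mathrm{diag}(a_{1,i+1/2},\ldots,a_{N,i+1/2})$ with non-negative numerical viscosities $a_{l,i+1/2}$, which may differ from interface to interface. Direct kinetic boundary treatment: at a boundary interface the upwind viscosity $a_l=|v_{l,x}|$ is used together with a ghost distribution in the adjacent ghost cell. At a fully diffuse wall at $x_{1/2}$ (normal pointing into the gas, in the $+x$-direction), with wall temperature $T_w>0$, gas constant $R>0$, wall velocity $\mathbf{u}_w\in\mathbb{R}^d$ having zero normal component, and $\mathcal{M}^w_l=(2\pi RT_w)^{-d/2}\exp(-|\mathbf{v}_l-\mathbf{u}_w|^2/(2RT_w))$, the ghost state is $$f^{\ast,n}_{0,l}=\begin{cases}f^{\ast,n}_{1,l},&v_{l,x}<0,\\ \sigma_w\mathcal{M}^w_l,&v_{l,x}>0,\end{cases}\qquad \sigma_w=-\frac{\sum_{l:v_{l,x}<0}\Delta v_lv_{l,x}f^{\ast,n}_{1,l}}{\sum_{l:v_{l,x}>0}\Delta v_lv_{l,x}\mathcal{M}^w_l},$$ (its value at nodes with $v_{l,x}=0$ does not enter the upwind flux and may be taken as $f^{\ast,n}_{1,l}$); the wall at $x_{N_x+1/2}$ is treated in the mirrored way, with its own wall parameters and the roles of $v_{l,x}>0$ and $v_{l,x}<0$ exchanged. The ghost state enters the flux formula at the boundary interface in the same way as a reconstruction, i.e.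 $\mathbf{F}^n_0=\mathbf{A}\mathcal{V}_x\mathbf{f}^{\ast,n}_0$. *)

theory Defs
  imports "HOL-Analysis.Analysis"
begin

definition multi_power :: "real^'d \<Rightarrow> ('d::finite \<Rightarrow> nat) \<Rightarrow> real" where
  "multi_power u \<alpha> = (\<Prod>i\<in>UNIV. (u $ i) ^ \<alpha> i)"

definition moment_matrix ::
  "('l::finite \<Rightarrow> real^'d::finite) \<Rightarrow> ('l \<Rightarrow> real) \<Rightarrow> ('m::finite \<Rightarrow> 'd \<Rightarrow> nat) \<Rightarrow> real^'l^'m" where
  "moment_matrix v dv \<alpha> = (\<chi> k l. dv l * multi_power (v l) (\<alpha> k))"

definition realizable :: "real^'l::finite^'m::finite \<Rightarrow> (real^'m) set" where
  "realizable A = {A *v f | f. \<forall>l. 0 < f $ l}"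

definition diag_matrix :: "('l::finite \<Rightarrow> real) \<Rightarrow> real^'l^'l" where
  "diag_matrix c = (\<chi> i j. if i = j then c i else 0)"


(* The convention 0 log 0 = 0 holds automatically, the product having a zero factor. *)
definition recon_objective ::
  "('l::finite \<Rightarrow> real) \<Rightarrow> ('l \<Rightarrow> real) \<Rightarrow> real \<Rightarrow> real^'l \<Rightarrow> real" where
  "recon_objective dv w lam g =
     (\<Sum>l\<in>UNIV. dv l * w l * g $ l * ln (w l * g $ l)) + lam * (\<Sum>l\<in>UNIV. \<bar>g $ l\<bar>)"

definition recon_feasible ::
  "real^'l::finite^'m::finite \<Rightarrow> ('l \<Rightarrow> real) \<Rightarrow> real^'m \<Rightarrow> real^'l \<Rightarrow> bool" where
  "recon_feasible A w m g \<longleftrightarrow>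
     (\<forall>l. 0 \<le> g $ l) \<and> (\<forall>k. (\<Sum>l\<in>UNIV. A $ k $ l * w l * g $ l) = m $ k)"

definition recon_minimizer ::
  "real^'l::finite^'m::finite \<Rightarrow> ('l \<Rightarrow> real) \<Rightarrow> ('l \<Rightarrow> real) \<Rightarrow> real \<Rightarrow> real^'m \<Rightarrow> real^'l" where
  "recon_minimizer A dv w lam m =
     (THE g. is_arg_min (recon_objective dv w lam) (recon_feasible A w m) g)"

definition reconstruct ::
  "real^'l::finite^'m::finite \<Rightarrow> ('l \<Rightarrow> real) \<Rightarrow> ('l \<Rightarrow> real) \<Rightarrow> real \<Rightarrow> real^'m \<Rightarrow> real^'l" where
  "reconstruct A dv w lam m = (\<chi> l. w l * recon_minimizer A dv w lam m $ l)"


definition wall_maxwellian :: "real \<Rightarrow> real \<Rightarrow> real^'d::finite \<Rightarrow> real^'d \<Rightarrow> real" where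
  "wall_maxwellian R T u v =
     (2 * pi * R * T) powr (- (real CARD('d) / 2)) * exp (- (norm (v - u))\<^sup>2 / (2 * R * T))"

(* c l is the component of the l-th node along the wall normal pointing into the gas:
   v_{l,x} at the left wall and -v_{l,x} at the right wall. In the quotient defining the wall
   density the sign of c cancels, so c = -v_{l,x} gives exactly the left-wall formula with the
   roles of v_{l,x} > 0 and v_{l,x} < 0 exchanged. *)
definition wall_density ::
  "('l::finite \<Rightarrow> real) \<Rightarrow> ('l \<Rightarrow> real) \<Rightarrow> ('l \<Rightarrow> real) \<Rightarrow> real^'l \<Rightarrow> real" where
  "wall_density dv c Mw f =
     - (\<Sum>l | c l < 0. dv l * c l * f $ l) / (\<Sum>l | c l > 0. dv l * c l * Mw l)"

definition diffuse_ghost ::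
  "('l::finite \<Rightarrow> real) \<Rightarrow> ('l \<Rightarrow> real) \<Rightarrow> ('l \<Rightarrow> real) \<Rightarrow> real^'l \<Rightarrow> real^'l" where
  "diffuse_ghost dv c Mw f = (\<chi> l. if c l > 0 then wall_density dv c Mw f * Mw l else f $ l)"

(* The cells are 1..Nx; 0 and Nx + 1 are the ghost cells. *)
definition cell_distribution ::
  "nat \<Rightarrow> (real^'m::finite \<Rightarrow> real^'l::finite) \<Rightarrow> (real^'l \<Rightarrow> real^'l) \<Rightarrow> (real^'l \<Rightarrow> real^'l) \<Rightarrow>
     (nat \<Rightarrow> real^'m) \<Rightarrow> nat \<Rightarrow> real^'l" where
  "cell_distribution Nx recon ghostL ghostR m i =
     (if i = 0 then ghostL (recon (m 1))
      else if i = Nx + 1 then ghostR (recon (m Nx))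
      else recon (m i))"


(* An interface index i in 0..Nx stands for x_{i+1/2}; the boundary interfaces are 0 and Nx. *)
definition boundary_upwind ::
  "nat \<Rightarrow> ('l \<Rightarrow> real) \<Rightarrow> (nat \<Rightarrow> 'l \<Rightarrow> real) \<Rightarrow> nat \<Rightarrow> 'l \<Rightarrow> real" where
  "boundary_upwind Nx vx a i l = (if i = 0 \<or> i = Nx then \<bar>vx l\<bar> else a i l)"

definition cell_flux ::
  "real^'l::finite^'m::finite \<Rightarrow> ('l \<Rightarrow> real) \<Rightarrow> real^'l \<Rightarrow> real^'m" where
  "cell_flux A vx f = (A ** diag_matrix vx) *v f"

definition low_order_flux ::
  "real^'l::finite^'m::finite \<Rightarrow> ('l \<Rightarrow> real) \<Rightarrow> (nat \<Rightarrow> 'l \<Rightarrow> real) \<Rightarrow> (nat \<Rightarrow> real^'l) \<Rightarrow> nat \<Rightarrow>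
     real^'m" where
  "low_order_flux A vx a f i =
     (1/2) *\<^sub>R (cell_flux A vx (f i) + cell_flux A vx (f (i + 1)))
     - (1/2) *\<^sub>R ((A ** diag_matrix (a i)) *v (f (i + 1) - f i))"

(* Only the values at the cells i in 1..Nx are meaningful, and they depend on no others. *)
primrec low_order_moments ::
  "real^'l::finite^'m::finite \<Rightarrow> ('l \<Rightarrow> real) \<Rightarrow> real \<Rightarrow> real \<Rightarrow> (nat \<Rightarrow> 'l \<Rightarrow> real) \<Rightarrow>
     ((nat \<Rightarrow> real^'m) \<Rightarrow> nat \<Rightarrow> real^'l) \<Rightarrow> (nat \<Rightarrow> real^'m) \<Rightarrow> nat \<Rightarrow> nat \<Rightarrow> real^'m" where
  "low_order_moments A vx dx dt a fs m0 0 = m0"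
| "low_order_moments A vx dx dt a fs m0 (Suc n) =
     (let m = low_order_moments A vx dx dt a fs m0 n; F = low_order_flux A vx a (fs m)
      in (\<lambda>i. m i - (dt / dx) *\<^sub>R (F i - F (i - 1))))"


definition viscosity_condition ::
  "nat \<Rightarrow> ('l \<Rightarrow> real) \<Rightarrow> real \<Rightarrow> real \<Rightarrow> (nat \<Rightarrow> 'l \<Rightarrow> real) \<Rightarrow> bool" where
  "viscosity_condition Nx vx dx dt a \<longleftrightarrow>
     (\<forall>i\<in>{0..Nx}. \<forall>l. \<bar>vx l\<bar> \<le> a i l \<and> a i l \<le> dx / dt)"

definition CFL :: "('l::finite \<Rightarrow> real) \<Rightarrow> real \<Rightarrow> real \<Rightarrow> bool" where
  "CFL vx dx dt \<longleftrightarrow> (MAX l. \<bar>vx l\<bar>) * (dt / dx) \<le> 1"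

definition lax_friedrichs :: "real \<Rightarrow> real \<Rightarrow> nat \<Rightarrow> 'l \<Rightarrow> real" where
  "lax_friedrichs dx dt i l = dx / dt"

definition upwind :: "('l \<Rightarrow> real) \<Rightarrow> nat \<Rightarrow> 'l \<Rightarrow> real" where
  "upwind vx i l = \<bar>vx l\<bar>"

definition global_rusanov :: "('l::finite \<Rightarrow> real) \<Rightarrow> nat \<Rightarrow> 'l \<Rightarrow> real" where
  "global_rusanov vx i l = (MAX k. \<bar>vx k\<bar>)"

end

theory Submission
  imports Defs "HOL-Real_Asymp.Real_Asymp"
begin

text \<open>The entropy \<open>h ln h\<close> is strictly convex with slope \<open>-\<infinity>\<close> at \<open>0\<close>, and the
  mass moment makes the feasible set compact; so for realizable moments the minimizer exists, is
  unique, and is positive at every node. Given positive distributions in all cells, the updated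
  moments of cell \<open>i\<close> are \<open>A\<close> applied to
  \<open>(1 - s (a\<^sub>+ + a\<^sub>-)) f\<^sub>i + s (a\<^sub>+ - v) f\<^sub>i\<^sub>+\<^sub>1 + s (a\<^sub>- + v) f\<^sub>i\<^sub>-\<^sub>1\<close> with
  \<open>s = \<Delta>t / (2 \<Delta>x)\<close>, which is a convex combination node by node exactly because of the
  viscosity condition. Positivity of the diffuse ghost states closes the argument at the walls.\<close>

section \<open>Positivity of the entropy minimizer\<close>

text \<open>The left side is the tangent of \<open>x ln x\<close> at \<open>z\<close>, in simplified
  form. For positive \<open>x\<close> the claim is \<open>ln y < y - 1\<close> at
  \<open>y = z / x\<close>, scaled by \<open>x\<close>; at \<open>x = 0\<close> it reads
  \<open>- z < 0\<close>.\<close>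

lemma entropy_tangent_less:
  fixes x z :: real
  assumes "0 \<le> x" "0 < z" "x \<noteq> z"
  shows "x * ln z + (x - z) < x * ln x"
proof (cases "x = 0")
  case False
  then have "0 < x" using assms by simp
  have "ln (z / x) < z / x - 1"
    using \<open>0 < x\<close> assms ln_le_minus_one[of "z / x"] ln_eq_minus_one[of "z / x"]
    by (fastforce simp: order_less_le)
  then have "x * ln (z / x) < x * (z / x - 1)"
    using \<open>0 < x\<close> by (rule mult_strict_left_mono)
  then show ?thesis
    using \<open>0 < x\<close> assms by (simp add: ln_div algebra_simps)
qed (use assms in simp)

lemma entropy_tangent_le:
  fixes x z :: real
  assumes "0 \<le> x" "0 < z"
  shows "x * ln z + (x - z) \<le> x * ln x"
  using entropy_tangent_less[OF assms] by (cases "x = z") auto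

text \<open>Sum of the two tangent bounds at the midpoint, where the linear remainders cancel. This
  is the strictness behind uniqueness.\<close>

lemma entropy_midpoint_less:
  fixes x y :: real
  assumes "0 \<le> x" "0 \<le> y" "x \<noteq> y"
  shows "2 * ((x + y) / 2 * ln ((x + y) / 2)) < x * ln x + y * ln y"
proof -
  define z where "z = (x + y) / 2"
  have z: "0 < z" "x \<noteq> z" "y \<noteq> z" "x + y = 2 * z"
    using assms by (auto simp: z_def)
  have "x * ln z + (x - z) + (y * ln z + (y - z)) < x * ln x + y * ln y"
    using entropy_tangent_less[of x z] entropy_tangent_less[of y z] assms z by simp
  moreover have "x * ln z + (x - z) + (y * ln z + (y - z)) = 2 * (z * ln z)"
  proof -
    have "x * ln z + (x - z) + (y * ln z + (y - z)) = (x + y) * ln z + (x + y) - 2 * z"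
      by (simp add: algebra_simps)
    then show ?thesis unfolding z(4) by simp
  qed
  ultimately show ?thesis by (simp add: z_def)
qed

text \<open>The extra term \<open>t q ln t\<close> at \<open>h = 0\<close> is of larger order than \<open>t\<close>; it is what
  excludes zeros of a minimizer.\<close>

lemma entropy_segment_le:
  fixes h q t :: real
  assumes "0 \<le> h" "0 < q" "0 < t" "t < 1"
  shows "((1 - t) * h + t * q) * ln ((1 - t) * h + t * q)
      \<le> (1 - t) * (h * ln h) + t * (q * ln q) + (if h = 0 then t * q * ln t else 0)"
proof (cases "h = 0")
  case True
  then show ?thesis using assms by (simp add: ln_mult algebra_simps)
next
  case False
  define z where "z = (1 - t) * h + t * q"
  have "0 < z" using assms False by (simp add: z_def add_nonneg_pos)
  \<comment> \<open>Both tangent bounds are taken at the convex combination \<open>z\<close> itself,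
    so the weighted linear remainders add up to zero.\<close>
  have "(1 - t) * (h * ln z + (h - z)) + t * (q * ln z + (q - z))
      \<le> (1 - t) * (h * ln h) + t * (q * ln q)"
    using assms \<open>0 < z\<close> by (intro add_mono mult_left_mono entropy_tangent_le) auto
  moreover have "(1 - t) * (h * ln z + (h - z)) + t * (q * ln z + (q - z))
      = ((1 - t) * h + t * q) * ln z + ((1 - t) * h + t * q - z)"
    by (simp add: algebra_simps)
  ultimately show ?thesis using False by (simp add: z_def)
qed

lemma continuous_on_entropy: "continuous_on {0..} (\<lambda>x::real. x * ln x)"
  unfolding continuous_on_def
proof
  fix x :: real assume "x \<in> {0..}"
  show "((\<lambda>x. x * ln x) \<longlongrightarrow> x * ln x) (at x within {0..})"
  proof (cases "x = 0")
    case True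
    have "((\<lambda>x::real. x * ln x) \<longlongrightarrow> 0) (at_right 0)" by real_asymp
    \<comment> \<open>The closed and the open half line differ only in the point 0, which the
      punctured filter ignores.\<close>
    moreover have "at 0 within {0..} = at_right (0::real)"
      by (rule at_within_nhd[of _ UNIV]) auto
    ultimately show ?thesis using True by simp
  next
    case False
    then show ?thesis by (intro tendsto_intros) auto
  qed
qed

section \<open>The constrained minimization: existence, positivity, uniqueness\<close>

lemma recon_objective_alt:
  "recon_objective dv w lam g
     = (\<Sum>l\<in>UNIV. dv l * ((w l * g $ l) * ln (w l * g $ l)) + lam * \<bar>g $ l\<bar>)"
  by (simp add: recon_objective_def sum.distrib sum_distrib_left mult.assoc)

lemma recon_feasible_convex:
  assumes "recon_feasible A w m g" "recon_feasible A w m p" "0 \<le> t" "t \<le> 1"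
  shows "recon_feasible A w m ((1 - t) *\<^sub>R g + t *\<^sub>R p)"
proof -
  have "(\<Sum>l\<in>UNIV. A $ k $ l * w l * ((1 - t) *\<^sub>R g + t *\<^sub>R p) $ l) = m $ k" for k
  proof -
    have "(\<Sum>l\<in>UNIV. A $ k $ l * w l * ((1 - t) *\<^sub>R g + t *\<^sub>R p) $ l)
        = (1 - t) * (\<Sum>l\<in>UNIV. A $ k $ l * w l * g $ l) + t * (\<Sum>l\<in>UNIV. A $ k $ l * w l * p $ l)"
      by (simp add: sum_distrib_left sum.distrib[symmetric] algebra_simps)
    then show ?thesis using assms by (simp add: recon_feasible_def algebra_simps)
  qed
  then show ?thesis using assms by (simp add: recon_feasible_def)
qed

text \<open>A row with positive entries bounds every coordinate: a single non-negative summand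
  cannot exceed the prescribed moment. The mass row will serve as row \<open>k\<close>.\<close>

lemma compact_recon_feasible:
  fixes A :: "real^'l::finite^'m::finite"
  assumes k: "\<forall>l. 0 < A $ k $ l" and w: "\<forall>l. 0 < w l"
  shows "compact {g. recon_feasible A w m g}"
proof -
  define b where "b l = m $ k / (A $ k $ l * w l)" for l
  have "g $ l \<le> b l" if g: "recon_feasible A w m g" for g l
  proof -
    have "A $ k $ l * w l * g $ l \<le> (\<Sum>l\<in>UNIV. A $ k $ l * w l * g $ l)"
      using g k w by (intro member_le_sum) (auto simp: recon_feasible_def less_imp_le)
    then show ?thesis
      using g k w by (simp add: recon_feasible_def b_def field_simps)
  qed
  then have "{g. recon_feasible A w m g} \<subseteq> cbox 0 (\<chi> l. b l)"
    by (auto simp: mem_box_cart recon_feasible_def)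
  then have "bounded {g. recon_feasible A w m g}"
    using bounded_cbox bounded_subset by blast
  moreover have "closed {g. recon_feasible A w m g}"
    unfolding recon_feasible_def
    by (intro closed_Collect_conj closed_Collect_all closed_Collect_le closed_Collect_eq
        continuous_intros)
  ultimately show ?thesis by (simp add: compact_eq_bounded_closed)
qed

text \<open>Feasible vectors may vanish at some nodes, so continuity of \<open>x ln x\<close> up to
  and including 0 is what matters here.\<close>

lemma continuous_on_recon_objective:
  assumes w: "\<forall>l. 0 < w l"
  shows "continuous_on {g. recon_feasible A w m g} (recon_objective dv w lam)"
proof -
  have "continuous_on {g. recon_feasible A w m g} (\<lambda>g. (w l * g $ l) * ln (w l * g $ l))" for l
    by (rule continuous_on_compose2[OF continuous_on_entropy, where f = "\<lambda>g. w l * g $ l"])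
      (use w in \<open>auto intro!: continuous_intros simp: recon_feasible_def less_imp_le\<close>)
  then show ?thesis
    unfolding recon_objective_alt[abs_def]
    by (intro continuous_on_sum continuous_on_add continuous_on_mult_left continuous_on_rabs
        continuous_on_component continuous_on_id)
qed

text \<open>Moving from \<open>g\<close> towards a positive feasible \<open>p\<close> by a fraction
  \<open>t\<close> changes the objective by at most \<open>t * (F p - F g + c * ln t)\<close>. If
  \<open>g\<close> has a zero, then \<open>c > 0\<close> and a small \<open>t\<close> gives a strict
  decrease.\<close>

lemma recon_argmin_pos:
  assumes dv: "\<forall>l. 0 < dv l" and w: "\<forall>l. 0 < w l"
    and p: "recon_feasible A w m p" "\<forall>l. 0 < p $ l"
    and g: "is_arg_min (recon_objective dv w lam) (recon_feasible A w m) g"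
  shows "0 < g $ l"
proof (rule ccontr)
  assume "\<not> 0 < g $ l"
  have gf: "recon_feasible A w m g" using g by (simp add: is_arg_min_def)
  then have g0: "0 \<le> g $ j" for j by (simp add: recon_feasible_def)
  have gl: "g $ l = 0" using \<open>\<not> 0 < g $ l\<close> g0[of l] by simp
  \<comment> \<open>Total coefficient of \<open>t * ln t\<close>, collected from the zeros of
    \<open>g\<close>; node \<open>l\<close> makes it positive.\<close>
  define c where "c = (\<Sum>j\<in>UNIV. if g $ j = 0 then dv j * (w j * p $ j) else 0)"
  have "0 < c" unfolding c_def
    by (rule sum_pos2[of _ l]) (use dv w p gl in \<open>auto simp: less_imp_le\<close>)
  let ?F = "recon_objective dv w lam"
  \<comment> \<open>Solves \<open>c * ln t = - (\<bar>F p - F g\<bar> + 1)\<close>, which pushes the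
    bracket \<open>F p - F g + c * ln t\<close> to at most -1.\<close>
  define t where "t = exp (- (\<bar>?F p - ?F g\<bar> + 1) / c)"
  have t: "0 < t" "t < 1" "c * ln t = - (\<bar>?F p - ?F g\<bar> + 1)"
    using \<open>0 < c\<close> by (auto simp: t_def divide_neg_pos)
  let ?h = "(1 - t) *\<^sub>R g + t *\<^sub>R p"
  have "dv j * ((w j * ?h $ j) * ln (w j * ?h $ j)) + lam * \<bar>?h $ j\<bar>
     \<le> (1 - t) * (dv j * ((w j * g $ j) * ln (w j * g $ j)) + lam * \<bar>g $ j\<bar>)
       + t * (dv j * ((w j * p $ j) * ln (w j * p $ j)) + lam * \<bar>p $ j\<bar>)
       + t * ln t * (if g $ j = 0 then dv j * (w j * p $ j) else 0)" for j
  proof -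
    have pos: "0 < dv j" "0 < w j" "0 < p $ j" using dv w p by auto
    have wh: "w j * ?h $ j = (1 - t) * (w j * g $ j) + t * (w j * p $ j)"
      by (simp add: algebra_simps)
    \<comment> \<open>On non-negative vectors the penalty is linear, so it adds no error
      term.\<close>
    have abs: "\<bar>?h $ j\<bar> = (1 - t) * \<bar>g $ j\<bar> + t * \<bar>p $ j\<bar>"
      using t pos g0[of j] by (simp add: abs_of_nonneg)
    have "dv j * ((w j * ?h $ j) * ln (w j * ?h $ j))
       \<le> dv j * ((1 - t) * ((w j * g $ j) * ln (w j * g $ j))
          + t * ((w j * p $ j) * ln (w j * p $ j))
          + (if w j * g $ j = 0 then t * (w j * p $ j) * ln t else 0))"
      unfolding wh using pos t g0[of j]
      by (intro mult_left_mono entropy_segment_le) auto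
    then show ?thesis
      unfolding abs using pos by (cases "g $ j = 0") (simp_all add: algebra_simps)
  qed
  then have "?F ?h \<le> (1 - t) * ?F g + t * ?F p + t * ln t * c"
    unfolding recon_objective_alt c_def sum_distrib_left sum.distrib[symmetric]
    by (intro sum_mono) (simp add: algebra_simps)
  also have "\<dots> = ?F g + t * (?F p - ?F g + c * ln t)"
    by (simp add: algebra_simps)
  also have "\<dots> < ?F g"
    using t by (simp add: mult_pos_neg)
  finally have "?F ?h < ?F g" .
  moreover have "recon_feasible A w m ?h"
    using gf p t by (intro recon_feasible_convex) auto
  ultimately show False using g by (auto simp: is_arg_min_def)
qed

text \<open>The midpoint of two distinct minimizers would be feasible with a smaller objective: the
  entropy gains strictly wherever they differ, and the penalty is linear on non-negative
  vectors.\<close>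

lemma recon_argmin_unique:
  assumes dv: "\<forall>l. 0 < dv l" and w: "\<forall>l. 0 < w l"
    and g: "is_arg_min (recon_objective dv w lam) (recon_feasible A w m) g"
    and g': "is_arg_min (recon_objective dv w lam) (recon_feasible A w m) g'"
  shows "g = g'"
proof (rule ccontr)
  assume "g \<noteq> g'"
  then obtain l where l: "g $ l \<noteq> g' $ l" by (auto simp: vec_eq_iff)
  let ?F = "recon_objective dv w lam"
  let ?T = "\<lambda>g j. dv j * ((w j * g $ j) * ln (w j * g $ j)) + lam * \<bar>g $ j\<bar>"
  \<comment> \<open>Written in this form to match \<open>recon_feasible_convex\<close> at
    \<open>t = 1/2\<close>.\<close>
  let ?h = "(1 - 1/2) *\<^sub>R g + (1/2) *\<^sub>R g'"
  have feas: "recon_feasible A w m g" "recon_feasible A w m g'"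
    using g g' by (auto simp: is_arg_min_def)
  then have nn: "0 \<le> g $ j" "0 \<le> g' $ j" for j by (auto simp: recon_feasible_def)
  have abs: "2 * \<bar>?h $ j\<bar> = \<bar>g $ j\<bar> + \<bar>g' $ j\<bar>" for j
    using nn[of j] by simp
  have wh: "w j * ?h $ j = (w j * g $ j + w j * g' $ j) / 2" for j
    by (simp add: algebra_simps)
  have strict: "2 * ?T ?h j < ?T g j + ?T g' j" if "g $ j \<noteq> g' $ j" for j
  proof -
    have pos: "0 < dv j" "0 < w j" using dv w by auto
    have "2 * ((w j * ?h $ j) * ln (w j * ?h $ j))
        < (w j * g $ j) * ln (w j * g $ j) + (w j * g' $ j) * ln (w j * g' $ j)"
      unfolding wh using pos nn[of j] that by (intro entropy_midpoint_less) auto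
    then have "dv j * (2 * ((w j * ?h $ j) * ln (w j * ?h $ j)))
        < dv j * ((w j * g $ j) * ln (w j * g $ j) + (w j * g' $ j) * ln (w j * g' $ j))"
      using pos by (intro mult_strict_left_mono)
    moreover have "lam * (2 * \<bar>?h $ j\<bar>) = lam * (\<bar>g $ j\<bar> + \<bar>g' $ j\<bar>)"
      unfolding abs ..
    ultimately show ?thesis by (simp only: distrib_left mult.left_commute[of 2])
  qed
  have "2 * ?T ?h j \<le> ?T g j + ?T g' j" for j
  proof (cases "g $ j = g' $ j")
    case True
    then have "?h $ j = g $ j" by simp
    then show ?thesis using True by simp
  qed (use strict in \<open>simp add: less_imp_le\<close>)
  then have "(\<Sum>j\<in>UNIV. 2 * ?T ?h j) < (\<Sum>j\<in>UNIV. ?T g j + ?T g' j)"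
    by (intro sum_strict_mono_ex1) (use strict[OF l] in auto)
  then have "2 * ?F ?h < ?F g + ?F g'"
    unfolding recon_objective_alt sum_distrib_left sum.distrib[of "?T g" "?T g'"] .
  moreover have "recon_feasible A w m ?h"
    using feas by (intro recon_feasible_convex) auto
  ultimately show False using g g' by (fastforce simp: is_arg_min_def not_less)
qed

text \<open>Dividing a positive representative of \<open>m\<close> by the weighting gives the
  positive competitor. It serves both existence and positivity of the minimizer.\<close>

lemma realizable_imp_feasible_pos:
  fixes A :: "real^'l::finite^'m::finite"
  assumes "m \<in> realizable A" and w: "\<forall>l. 0 < w l"
  obtains p where "recon_feasible A w m p" "\<forall>l. 0 < p $ l"
proof -
  obtain f where f: "m = A *v f" "\<forall>l. 0 < f $ l"
    using assms by (auto simp: realizable_def)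
  have "A $ k $ l * w l * (f $ l / w l) = A $ k $ l * f $ l" for k l
    using w by (simp add: less_imp_neq[THEN not_sym])
  then have "recon_feasible A w m (\<chi> l. f $ l / w l)"
    using f w by (simp add: recon_feasible_def matrix_vector_mult_def less_imp_le)
  then show ?thesis using f w by (intro that[of "\<chi> l. f $ l / w l"]) auto
qed

text \<open>Justifies the definite description: compactness gives a minimizer, strict convexity
  makes it the only one.\<close>

lemma recon_minimizer_is_arg_min:
  fixes A :: "real^'l::finite^'m::finite"
  assumes k: "\<forall>l. 0 < A $ k $ l" and dv: "\<forall>l. 0 < dv l" and w: "\<forall>l. 0 < w l"
    and m: "m \<in> realizable A"
  shows "is_arg_min (recon_objective dv w lam) (recon_feasible A w m)
           (recon_minimizer A dv w lam m)"
proof -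
  obtain p where "recon_feasible A w m p"
    using realizable_imp_feasible_pos[OF m w] by blast
  then have "{g. recon_feasible A w m g} \<noteq> {}" by blast
  then obtain g where g: "is_arg_min (recon_objective dv w lam) (recon_feasible A w m) g"
    using continuous_attains_inf[OF compact_recon_feasible[OF k w] _ continuous_on_recon_objective[OF w]]
    by (fastforce simp: is_arg_min_def not_less)
  then show ?thesis
    unfolding recon_minimizer_def by (rule theI) (rule recon_argmin_unique[OF dv w _ g])
qed

lemma reconstruct_pos:
  fixes A :: "real^'l::finite^'m::finite"
  assumes "\<forall>l. 0 < A $ k $ l" "\<forall>l. 0 < dv l" and w: "\<forall>l. 0 < w l" and "m \<in> realizable A"
  shows "0 < reconstruct A dv w lam m $ l"
proof -
  obtain p where "recon_feasible A w m p" "\<forall>l. 0 < p $ l"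
    using realizable_imp_feasible_pos[OF assms(4) w] .
  then show ?thesis
    using recon_argmin_pos[OF assms(2,3) _ _ recon_minimizer_is_arg_min[OF assms]] w
    by (simp add: reconstruct_def)
qed

lemma moments_reconstruct:
  fixes A :: "real^'l::finite^'m::finite"
  assumes "\<forall>l. 0 < A $ k $ l" "\<forall>l. 0 < dv l" "\<forall>l. 0 < w l" "m \<in> realizable A"
  shows "A *v reconstruct A dv w lam m = m"
  using recon_minimizer_is_arg_min[OF assms, of lam]
  by (simp add: is_arg_min_def recon_feasible_def reconstruct_def matrix_vector_mult_def
      vec_eq_iff mult.assoc)

section \<open>Positivity of the update\<close>

lemma wall_maxwellian_pos:
  assumes "0 < R" "0 < T"
  shows "0 < wall_maxwellian R T u v"
  using assms by (simp add: wall_maxwellian_def)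

text \<open>Nodes of both signs keep both sums in the wall density non-empty. The flux towards the
  wall is negative, so its negation over the positive Maxwellian flux is positive.\<close>

lemma diffuse_ghost_pos:
  assumes dv: "\<forall>l. 0 < dv l" and f: "\<forall>l. 0 < f $ l" and Mw: "\<forall>l. 0 < Mw l"
    and "\<exists>l. 0 < c l" "\<exists>l. c l < 0"
  shows "0 < diffuse_ghost dv c Mw f $ l"
proof -
  have "(\<Sum>l | c l < 0. - (dv l * c l * f $ l)) > 0"
    using assms by (intro sum_pos) (auto simp: mult_pos_neg mult_neg_pos)
  moreover have "(\<Sum>l | c l > 0. dv l * c l * Mw l) > 0"
    using assms by (intro sum_pos) auto
  ultimately have "0 < wall_density dv c Mw f"
    unfolding wall_density_def by (simp add: sum_negf divide_neg_pos)
  then show ?thesis using f Mw by (simp add: diffuse_ghost_def)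
qed

section \<open>The scheme at the level of distributions\<close>

lemma diag_matrix_mult_vector_nth: "(diag_matrix c *v f) $ l = c l * f $ l"
  by (simp add: diag_matrix_def matrix_vector_mult_def if_distrib[of "\<lambda>x. x * _"] cong: if_cong)

text \<open>Factoring out \<open>A\<close> reduces realizability of the update to positivity of a
  vector, checked node by node.\<close>

lemma low_order_flux_eq:
  "low_order_flux A vx a f i
     = A *v (\<chi> l. (vx l * (f i $ l + f (i + 1) $ l) - a i l * (f (i + 1) $ l - f i $ l)) / 2)"
proof -
  have "low_order_flux A vx a f i
      = A *v ((1/2) *\<^sub>R (diag_matrix vx *v f i + diag_matrix vx *v f (i + 1))
          - (1/2) *\<^sub>R (diag_matrix (a i) *v (f (i + 1) - f i)))"
    by (simp add: low_order_flux_def cell_flux_def matrix_vector_mul_assoc[symmetric]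
        matrix_vector_mult_diff_distrib matrix_vector_right_distrib matrix_vector_mult_scaleR)
  also have "(1/2) *\<^sub>R (diag_matrix vx *v f i + diag_matrix vx *v f (i + 1))
          - (1/2) *\<^sub>R (diag_matrix (a i) *v (f (i + 1) - f i))
      = (\<chi> l. (vx l * (f i $ l + f (i + 1) $ l) - a i l * (f (i + 1) $ l - f i $ l)) / 2)"
    by (simp add: vec_eq_iff diag_matrix_mult_vector_nth field_simps)
  finally show ?thesis .
qed

lemma convex_combination3_pos:
  fixes x y z :: real
  assumes "0 < x" "0 < y" "0 < z" "0 \<le> a" "0 \<le> b" "0 \<le> c" "a + b + c = 1"
  shows "0 < a * x + b * y + c * z"
proof -
  have "(a + b + c) * min x (min y z) \<le> a * x + b * y + c * z"
    unfolding distrib_right using assms by (intro add_mono mult_left_mono) auto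
  then show ?thesis using assms by simp
qed

lemma realizable_low_order_update:
  assumes f: "\<forall>l. 0 < f i $ l" "\<forall>l. 0 < f (i + 1) $ l" "\<forall>l. 0 < f (i - 1) $ l"
    and i: "1 \<le> i" and d: "0 < dx" "0 < dt"
    and a: "\<forall>l. \<bar>vx l\<bar> \<le> a i l \<and> a i l \<le> dx / dt"
      "\<forall>l. \<bar>vx l\<bar> \<le> a (i - 1) l \<and> a (i - 1) l \<le> dx / dt"
  shows "A *v f i - (dt / dx) *\<^sub>R (low_order_flux A vx a f i - low_order_flux A vx a f (i - 1))
           \<in> realizable A"
proof -
  define s where "s = dt / (2 * dx)"
  have s: "0 < s" "dt / dx = 2 * s" "s * (dx / dt) = 1 / 2" using d by (auto simp: s_def)
  \<comment> \<open>The coefficients sum to 1. The neighbour weights are non-negative by the lower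
    viscosity bound, the central one by the upper bound.\<close>
  define h :: "real^'a" where "h = (\<chi> l. (1 - s * (a i l + a (i - 1) l)) * f i $ l
      + s * (a i l - vx l) * f (i + 1) $ l + s * (a (i - 1) l + vx l) * f (i - 1) $ l)"
  have "0 < h $ l" for l
  proof -
    have le: "\<bar>vx l\<bar> \<le> a i l" "a i l \<le> dx / dt" "\<bar>vx l\<bar> \<le> a (i - 1) l" "a (i - 1) l \<le> dx / dt"
      using a by auto
    have "s * (a i l + a (i - 1) l) \<le> s * (dx / dt + dx / dt)"
      using s le by (intro mult_left_mono add_mono) auto
    also have "\<dots> = 1" using s(3) by (simp only: distrib_left)
    finally have "0 \<le> 1 - s * (a i l + a (i - 1) l)" by simp
    moreover have "0 \<le> s * (a i l - vx l)" "0 \<le> s * (a (i - 1) l + vx l)"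
      using s le by auto
    ultimately show ?thesis
      unfolding h_def vec_lambda_beta using f
      by (intro convex_combination3_pos) (auto simp: algebra_simps)
  qed
  moreover have "A *v f i - (dt / dx) *\<^sub>R (low_order_flux A vx a f i - low_order_flux A vx a f (i - 1))
      = A *v h"
  proof -
    define F where
      "F j = (\<chi> l. (vx l * (f j $ l + f (j + 1) $ l) - a j l * (f (j + 1) $ l - f j $ l)) / 2)" for j
    \<comment> \<open>Because \<open>1 \<le> i\<close>, truncated subtraction satisfies
      \<open>i - 1 + 1 = i\<close>; both fluxes then contain \<open>f i\<close>, and its transport
      parts cancel.\<close>
    have "f i - (dt / dx) *\<^sub>R (F i - F (i - 1)) = h"
      using i by (simp add: vec_eq_iff F_def h_def s(2) field_simps)
    then show ?thesis
      unfolding low_order_flux_eq F_def[symmetric]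
      by (simp flip: matrix_vector_mult_diff_distrib matrix_vector_mult_scaleR)
  qed
  ultimately show ?thesis by (auto simp: realizable_def)
qed

text \<open>Induction over time steps for an abstract map \<open>fs\<close>. Positivity is required
  up to both ghost cells, since the update of cells 1 and \<open>Nx\<close> reads them; moment
  consistency is required only inside.\<close>

lemma low_order_moments_realizable:
  assumes pos: "\<And>m i. (\<forall>i\<in>{1..Nx}. m i \<in> realizable A) \<Longrightarrow> i \<le> Nx + 1 \<Longrightarrow> \<forall>l. 0 < fs m i $ l"
    and mom: "\<And>m i. (\<forall>i\<in>{1..Nx}. m i \<in> realizable A) \<Longrightarrow> i \<in> {1..Nx} \<Longrightarrow> A *v fs m i = m i"
    and d: "0 < dx" "0 < dt" and visc: "viscosity_condition Nx vx dx dt a"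
    and m0: "\<forall>i\<in>{1..Nx}. m0 i \<in> realizable A"
  shows "\<forall>i\<in>{1..Nx}. low_order_moments A vx dx dt a fs m0 n i \<in> realizable A"
proof (induction n)
  case 0
  show ?case using m0 by simp
next
  case (Suc n)
  let ?m = "low_order_moments A vx dx dt a fs m0 n"
  show ?case
  proof
    fix i assume i: "i \<in> {1..Nx}"
    have "A *v fs ?m i - (dt / dx) *\<^sub>R (low_order_flux A vx a (fs ?m) i
        - low_order_flux A vx a (fs ?m) (i - 1)) \<in> realizable A"
      using i visc d by (intro realizable_low_order_update pos[OF Suc.IH])
        (auto simp: viscosity_condition_def)
    then show "low_order_moments A vx dx dt a fs m0 (Suc n) i \<in> realizable A"
      using mom[OF Suc.IH i] by (simp add: Let_def)
  qed
qed

section \<open>The CFL condition\<close>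

lemma CFL_iff:
  fixes vx :: "'l::finite \<Rightarrow> real"
  assumes "0 < dx" "0 < dt"
  shows "CFL vx dx dt \<longleftrightarrow> (\<forall>l. \<bar>vx l\<bar> \<le> dx / dt)"
proof -
  have "CFL vx dx dt \<longleftrightarrow> (MAX l. \<bar>vx l\<bar>) \<le> dx / dt"
    using assms by (simp add: CFL_def field_simps)
  also have "\<dots> \<longleftrightarrow> (\<forall>l. \<bar>vx l\<bar> \<le> dx / dt)" by simp
  finally show ?thesis .
qed

lemma viscosity_condition_standard:
  fixes vx :: "'l::finite \<Rightarrow> real"
  assumes d: "0 < dx" "0 < dt" and "CFL vx dx dt"
    and "a \<in> {lax_friedrichs dx dt, upwind vx, global_rusanov vx}"
  shows "viscosity_condition Nx vx dx dt a"
proof -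
  have "\<forall>l. \<bar>vx l\<bar> \<le> dx / dt" using assms CFL_iff by blast
  moreover from this have "(MAX l. \<bar>vx l\<bar>) \<le> dx / dt" by simp
  moreover have "\<bar>vx l\<bar> \<le> (MAX l. \<bar>vx l\<bar>)" for l by simp
  ultimately show ?thesis
    using assms(4)
    by (auto simp: viscosity_condition_def lax_friedrichs_def upwind_def global_rusanov_def)
qed

text \<open>Interface 0 belongs to the range for every \<open>Nx\<close>, and chaining the two
  bounds there is enough.\<close>

lemma viscosity_condition_imp_CFL:
  fixes vx :: "'l::finite \<Rightarrow> real"
  assumes "0 < dx" "0 < dt" "viscosity_condition Nx vx dx dt a"
  shows "CFL vx dx dt"
proof -
  have "\<bar>vx l\<bar> \<le> a 0 l \<and> a 0 l \<le> dx / dt" for l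
    using assms(3) by (simp add: viscosity_condition_def)
  then show ?thesis using CFL_iff[OF assms(1,2)] order_trans by blast
qed

text \<open>At the two walls the upper bound for the upwind value comes from the CFL condition. This
  transfers the three standard choices to the scheme with kinetic walls.\<close>

lemma viscosity_condition_boundary_upwind:
  fixes vx :: "'l::finite \<Rightarrow> real"
  assumes "0 < dx" "0 < dt" "viscosity_condition Nx vx dx dt a"
  shows "viscosity_condition Nx vx dx dt (boundary_upwind Nx vx a)"
  using assms viscosity_condition_imp_CFL[OF assms]
  by (auto simp: CFL_iff viscosity_condition_def boundary_upwind_def)

theorem theorem5:
  fixes v :: "'l::finite \<Rightarrow> real^'d::finite" and dv :: "'l \<Rightarrow> real"
    and \<alpha> :: "'m::finite \<Rightarrow> 'd \<Rightarrow> nat" and x :: 'd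
    and w :: "'l \<Rightarrow> real" and lam :: real
    and Nx :: nat and dx dt :: real
    and R TL TR :: real and uL uR :: "real^'d"
    and m0 :: "nat \<Rightarrow> real^'m"
  defines "A \<equiv> moment_matrix v dv \<alpha>"
    and "vx \<equiv> (\<lambda>l. v l $ x)"
  defines "ghostL \<equiv> diffuse_ghost dv vx (\<lambda>l. wall_maxwellian R TL uL (v l))"
    and "ghostR \<equiv> diffuse_ghost dv (\<lambda>l. - vx l) (\<lambda>l. wall_maxwellian R TR uR (v l))"
  defines "fs \<equiv> cell_distribution Nx (reconstruct A dv w lam) ghostL ghostR"
  defines "m \<equiv> (\<lambda>a. low_order_moments A vx dx dt (boundary_upwind Nx vx a) fs m0)"
  assumes "\<forall>l. 0 < dv l"
    and "\<exists>k. \<alpha> k = (\<lambda>_. 0)"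
    and "CARD('m) < CARD('l)"
    and "rank A = CARD('m)"
    and "\<exists>l. 0 < vx l"
    and "\<exists>l. vx l < 0"
    and "\<forall>l. 0 < w l"
    and "0 \<le> lam"
    and "1 \<le> Nx"
    and "0 < dx"
    and "0 < dt"
    and "0 < R"
    and "0 < TL"
    and "0 < TR"
    and "uL $ x = 0"
    and "uR $ x = 0"
    and "\<forall>i\<in>{1..Nx}. m0 i \<in> realizable A"
  shows "(\<forall>a. (\<forall>i\<in>{1..<Nx}. \<forall>l. 0 \<le> a i l) \<longrightarrow>
             viscosity_condition Nx vx dx dt (boundary_upwind Nx vx a) \<longrightarrow>
             (\<forall>n. \<forall>i\<in>{1..Nx}. m a n i \<in> realizable A)) \<and>
         ((\<exists>a. viscosity_condition Nx vx dx dt a) \<longleftrightarrow> CFL vx dx dt) \<and>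
         ((\<forall>l. {\<bar>vx l\<bar>..dx / dt} \<noteq> {}) \<longleftrightarrow> CFL vx dx dt) \<and>
         (CFL vx dx dt \<longrightarrow>
             (\<forall>a\<in>{lax_friedrichs dx dt, upwind vx, global_rusanov vx}.
                viscosity_condition Nx vx dx dt a)) \<and>
         (CFL vx dx dt \<longrightarrow>
             (\<forall>i\<in>{0..Nx}. \<forall>l. upwind vx i l = Inf {\<bar>vx l\<bar>..dx / dt} \<and>
                              lax_friedrichs dx dt i l = Sup {\<bar>vx l\<bar>..dx / dt})) \<and>
         (CFL vx dx dt \<longrightarrow>
             (\<forall>a\<in>{lax_friedrichs dx dt, upwind vx, global_rusanov vx}.
                \<forall>n. \<forall>i\<in>{1..Nx}. m a n i \<in> realizable A))"
proof -
  note dv = assms(7) and w = assms(13) and Nx = assms(15) and d = assms(16,17)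
  obtain k where "\<alpha> k = (\<lambda>_. 0)" using assms(8) by blast
  \<comment> \<open>The zero multi-index gives the mass row: its monomial is 1 at every node, also
    where a velocity component vanishes, as \<open>0 ^ 0 = 1\<close>. The entries are thus the
    weights \<open>dv\<close>.\<close>
  then have k: "\<forall>l. 0 < A $ k $ l"
    using dv by (simp add: A_def moment_matrix_def multi_power_def)
  have pos: "\<forall>l. 0 < fs \<mu> i $ l"
    if \<mu>: "\<forall>i\<in>{1..Nx}. \<mu> i \<in> realizable A" and i: "i \<le> Nx + 1" for \<mu> i
  proof -
    have rec: "\<forall>l. 0 < reconstruct A dv w lam (\<mu> j) $ l" if "j \<in> {1..Nx}" for j
      using reconstruct_pos[OF k dv w] \<mu> that by blast
    have "\<forall>l. 0 < ghostL (reconstruct A dv w lam (\<mu> 1)) $ l"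
      unfolding ghostL_def using rec[of 1] Nx dv assms(11,12,18,19)
      by (intro allI diffuse_ghost_pos) (auto simp: wall_maxwellian_pos)
    \<comment> \<open>With the normal component \<open>- vx\<close> the two sign hypotheses on the
      grid swap roles.\<close>
    moreover have "\<forall>l. 0 < ghostR (reconstruct A dv w lam (\<mu> Nx)) $ l"
      unfolding ghostR_def using rec[of Nx] Nx dv assms(11,12,18,20)
      by (intro allI diffuse_ghost_pos) (auto simp: wall_maxwellian_pos)
    ultimately show ?thesis
      using rec[of i] i by (simp add: fs_def cell_distribution_def)
  qed
  have mom: "A *v fs \<mu> i = \<mu> i"
    if "\<forall>i\<in>{1..Nx}. \<mu> i \<in> realizable A" "i \<in> {1..Nx}" for \<mu> i
    using that moments_reconstruct[OF k dv w] by (simp add: fs_def cell_distribution_def)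
  have main: "\<forall>i\<in>{1..Nx}. m a n i \<in> realizable A"
    if "viscosity_condition Nx vx dx dt (boundary_upwind Nx vx a)" for a n
    unfolding m_def
    by (rule low_order_moments_realizable) (fact pos mom d that assms(23))+
  have std: "viscosity_condition Nx vx dx dt a"
    if "CFL vx dx dt" "a \<in> {lax_friedrichs dx dt, upwind vx, global_rusanov vx}" for a
    using that viscosity_condition_standard d by blast
  have ex: "(\<exists>a. viscosity_condition Nx vx dx dt a) \<longleftrightarrow> CFL vx dx dt"
    using std viscosity_condition_imp_CFL[OF d] by blast
  have nonempty: "(\<forall>l. {\<bar>vx l\<bar>..dx / dt} \<noteq> {}) \<longleftrightarrow> CFL vx dx dt"
    using CFL_iff[OF d, of vx] by simp
  \<comment> \<open>The CFL condition makes the closed interval non-empty, so infimum and supremum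
    are its endpoints.\<close>
  have endpoints: "upwind vx i l = Inf {\<bar>vx l\<bar>..dx / dt} \<and>
      lax_friedrichs dx dt i l = Sup {\<bar>vx l\<bar>..dx / dt}" if "CFL vx dx dt" for i l
    using that CFL_iff[OF d, of vx] by (simp add: upwind_def lax_friedrichs_def)
  show ?thesis
    using main std ex nonempty endpoints viscosity_condition_boundary_upwind[OF d std] by blast
qed

end
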